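(* Let $\mathbf{k}$ be a field of characteristic zero and let $X$ be a set. Let $\mathfrak{R}$ be the set of Reynolds words on $X$, let $\mathbf{k}\mathfrak{R}$ be the $\mathbf{k}$-vector space with basis $\mathfrak{R}$, equipped with the concatenation product and the linear operator $P:\mathbf{k}\mathfrak{R}\to\mathbf{k}\mathfrak{R}$ defined in the context, and let $i:X\hookrightarrow \mathbf{k}\mathfrak{R}$ be the natural inclusion. Then the Reynolds algebra $(\mathbf{k}\mathfrak{R},P)$ together with $i$ is the free Reynolds algebra on $X$: for any Reynolds algebra $(A,Q)$ over $\mathbf{k}$ and any set map $f:X\to A$, there exists a unique Reynolds algebra homomorphism $\bar f:\mathbf{k}\mathfrak{R}\to A$ such that $\bar f\circ i=f$.
   Context: All algebras are unitary associative $\mathbf{k}$-algebras, and algebra homomorphisms are unitary. A Reynolds algebra over $\mathbf{k}$ is a pair $(R,P)$ with $R$ a $\mathbf{k}$-algebra and $P:R\to R$ a $\mathbf{k}$-linear map satisfying the Reynolds identity $P(u)P(v)=P(uP(v))+P(P(u)v)-P(P(u)P(v))$ for all $u,v\in R$. A Reynolds algebra homomorphism $f:(R_1,P_1)\to(R_2,P_2)$ is an algebra homomorphism with $fP_1=P_2f$. Bracketed words. For a set $Y$ let $M(Y)$ be the free monoid on $Y$ with identity $\mathbf{1}$, and let $\lfloor Y\rfloor=\{\lfloor y\rfloor : y\in Y\}$ be a copy of $Y$ disjoint from $Y$. Put $\mathfrak{M}_0=M(X)$ and $\mathfrak{M}_n=M(X\sqcup\lfloor\mathfrak{M}_{n-1}\rfloor)$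 for $n\ge1$, with the natural inclusions $\mathfrak{M}_{n-1}\hookrightarrow\mathfrak{M}_n$, and $\mathfrak{M}(X)=\varinjlim\mathfrak{M}_n$, so that $\mathfrak{M}(X)=M(X\sqcup\lfloor\mathfrak{M}(X)\rfloor)$. Elements of $\mathfrak{M}(X)$ are called bracketed words. Reynolds words. A bracketed word is a Reynolds word if it contains no subword of the form $\lfloor\lfloor u_1\rfloor\cdots\lfloor u_n\rfloor\rfloor$ with $n\ge2$ and $u_1,\dots,u_n\in\mathfrak{M}(X)$. Let $\mathfrak{R}$ be the set of Reynolds words. Let $\mathfrak{R}''\subseteq\mathfrak{R}$ be the set of Reynolds words of the form $\lfloor s_1\rfloor\cdots\lfloor s_m\rfloor$ with $m\ge2$ and $s_j\in\mathfrak{R}$, and let $\mathfrak{R}'=\mathfrak{R}\setminus\mathfrak{R}''$. Then $\mathfrak{R}=M(X\sqcup\lfloor\mathfrak{R}'\rfloor)$; in particular $\mathfrak{R}$ is closed under concatenation, and $\lfloor r\rfloor\in\mathfrak{R}$ for $r\in\mathfrak{R}'$. The product on $\mathbf{k}\mathfrak{R}$ is the bilinear extension of concatenation. The operator $P$. Write $\lfloor r\rfloor^{(n)}$ for $n$ nested brackets around $r$ (so $\lfloor r\rfloor^{(0)}=r$). The linear map $P:\mathbf{k}\mathfrak{R}\to\mathbf{k}\mathfrak{R}$ is defined on the basis $\mathfrak{R}$ as follows. If $r\in\mathfrak{R}'$, then $P(r)=\lfloor r\rfloor$. If $r\in\mathfrak{R}''$, write uniquely $r=\lfloor r_1\rfloor^{(n_1)}\cdots\lfloor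 r_m\rfloor^{(n_m)}$ with $m\ge2$, $n_j\ge1$ and $r_j\in\mathfrak{R}'\setminus\lfloor\mathfrak{R}'\rfloor$, and define, recursively on $n_1+\cdots+n_m$, $$P(r)=\frac1{m-1}\Big(\sum_{i=1}^m P\big(\lfloor r_1\rfloor^{(n_1)}\cdots\lfloor r_{i-1}\rfloor^{(n_{i-1})}\lfloor r_i\rfloor^{(n_i-1)}\lfloor r_{i+1}\rfloor^{(n_{i+1})}\cdots\lfloor r_m\rfloor^{(n_m)}\big)-r\Big).$$ *)

theory Defs
  imports "HOL-Algebra.Algebraic_Closure_Type" "HOL-Library.Poly_Mapping"
begin

text \<open>
  Algebras are \<open>HOL-Algebra\<close> records. The library locale \<open>algebra\<close> is for commutative algebras
  only, so the noncommutative notion is introduced here. The zero algebra is allowed.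
\<close>

locale assoc_algebra = module + ring M +
  assumes smult_mult_left:
      "\<lbrakk>a \<in> carrier R; x \<in> carrier M; y \<in> carrier M\<rbrakk> \<Longrightarrow>
        a \<odot>\<^bsub>M\<^esub> (x \<otimes>\<^bsub>M\<^esub> y) = (a \<odot>\<^bsub>M\<^esub> x) \<otimes>\<^bsub>M\<^esub> y"
    and smult_mult_right:
      "\<lbrakk>a \<in> carrier R; x \<in> carrier M; y \<in> carrier M\<rbrakk> \<Longrightarrow>
        a \<odot>\<^bsub>M\<^esub> (x \<otimes>\<^bsub>M\<^esub> y) = x \<otimes>\<^bsub>M\<^esub> (a \<odot>\<^bsub>M\<^esub> y)"

locale reynolds_algebra = assoc_algebra +
  fixes P
  assumes P_closed: "P \<in> carrier M \<rightarrow> carrier M"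
    and P_add: "\<lbrakk>u \<in> carrier M; v \<in> carrier M\<rbrakk> \<Longrightarrow> P (u \<oplus>\<^bsub>M\<^esub> v) = P u \<oplus>\<^bsub>M\<^esub> P v"
    and P_smult: "\<lbrakk>a \<in> carrier R; u \<in> carrier M\<rbrakk> \<Longrightarrow> P (a \<odot>\<^bsub>M\<^esub> u) = a \<odot>\<^bsub>M\<^esub> P u"
    and reynolds_identity:
      "\<lbrakk>u \<in> carrier M; v \<in> carrier M\<rbrakk> \<Longrightarrow>
        P u \<otimes>\<^bsub>M\<^esub> P v =
          P (u \<otimes>\<^bsub>M\<^esub> P v) \<oplus>\<^bsub>M\<^esub> P (P u \<otimes>\<^bsub>M\<^esub> v) \<ominus>\<^bsub>M\<^esub> P (P u \<otimes>\<^bsub>M\<^esub> P v)"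

definition reynolds_hom ::
    "('k, 'm) ring_scheme \<Rightarrow> ('k, 'a, 'n) module_scheme \<Rightarrow> ('a \<Rightarrow> 'a)
      \<Rightarrow> ('k, 'b, 'l) module_scheme \<Rightarrow> ('b \<Rightarrow> 'b) \<Rightarrow> ('a \<Rightarrow> 'b) set"
  where "reynolds_hom K A P B Q =
    {h \<in> ring_hom A B.
      (\<forall>c \<in> carrier K. \<forall>u \<in> carrier A. h (c \<odot>\<^bsub>A\<^esub> u) = c \<odot>\<^bsub>B\<^esub> h u) \<and>
      (\<forall>u \<in> carrier A. h (P u) = Q (h u))}"

text \<open>
  Bracketed words: the type below is the solution of \<open>W = M(V \<squnion> \<lfloor>W\<rfloor>)\<close> for the alphabet \<open>V\<close>, with
  \<open>Br w\<close> for \<open>\<lfloor>w\<rfloor>\<close>, list append for concatenation and the empty list for the identity word.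
  The alphabet is a set of elements of a type, since types are never empty and it may be.
  (It is not called \<open>X\<close> because \<open>HOL-Algebra\<close> uses that token as syntax.)
\<close>

datatype 'x letter = Var 'x | Br (unBr: "'x letter list")

type_synonym 'x bword = "'x letter list"

inductive_set bracketed_words :: "'x set \<Rightarrow> 'x bword set" for V :: "'x set"
  where
    Nil: "[] \<in> bracketed_words V"
  | Var: "\<lbrakk>x \<in> V; w \<in> bracketed_words V\<rbrakk> \<Longrightarrow> Var x # w \<in> bracketed_words V"
  | Br: "\<lbrakk>u \<in> bracketed_words V; w \<in> bracketed_words V\<rbrakk> \<Longrightarrow> Br u # w \<in> bracketed_words V"

text \<open>Subwords may occur at any depth inside the brackets.\<close>

inductive subword :: "'x bword \<Rightarrow> 'x bword \<Rightarrow> bool" for u :: "'x bword"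
  where
    here: "subword u (a @ u @ b)"
  | inside: "subword u v \<Longrightarrow> subword u (a @ Br v # b)"

definition bracket_product :: "'x bword \<Rightarrow> bool"
  where "bracket_product w \<longleftrightarrow> (\<exists>us. length us \<ge> 2 \<and> w = map Br us)"

definition reynolds_words :: "'x set \<Rightarrow> 'x bword set"
  where "reynolds_words V =
    {w \<in> bracketed_words V. \<not> (\<exists>u. bracket_product u \<and> subword [Br u] w)}"

abbreviation pm_smult :: "'k::field_char_0 \<Rightarrow> ('b \<Rightarrow>\<^sub>0 'k) \<Rightarrow> ('b \<Rightarrow>\<^sub>0 'k)"
  where "pm_smult c p \<equiv> Poly_Mapping.map ((*) c) p"

text \<open>
  The operator on basis words. A Reynolds word lies in \<open>\<RR>''\<close> iff it is a \<open>bracket_product\<close>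
  (its factors are then Reynolds words automatically). If the \<open>i\<close>-th factor of \<open>r\<close> is
  \<open>\<lfloor>r\<^sub>i\<rfloor>\<close> bracketed \<open>n\<^sub>i \<ge> 1\<close> times, i.e. the letter \<open>Br s\<close>, then the same factor with \<open>n\<^sub>i - 1\<close> brackets
  is the word \<open>s\<close>, which is spliced into \<open>r\<close> in place of that letter. For \<open>n\<^sub>i = 1\<close> it is
  \<open>r\<^sub>i\<close>, which may be the empty word or have several letters.
\<close>

function bracket_op :: "'x bword \<Rightarrow> ('x bword \<Rightarrow>\<^sub>0 'k::field_char_0)"
  where "bracket_op r =
    (if bracket_product r
     then pm_smult (1 / of_nat (length r - 1))
       ((\<Sum>i<length r. bracket_op (take i r @ unBr (r ! i) @ drop (Suc i) r))
         - Poly_Mapping.single r 1)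
     else Poly_Mapping.single [Br r] 1)"
  by pat_completeness auto
termination
proof (relation "measure (size_list size)")
  fix r :: "'x bword" and i
  assume r: "bracket_product r" and "i \<in> {..<length r}"
  then have i: "i < length r" by simp
  with r obtain s where s: "r ! i = Br s"
    by (auto simp: bracket_product_def)
  have "size_list size r = size_list size (take i r @ r ! i # drop (Suc i) r)"
    using i by (simp add: id_take_nth_drop[symmetric])
  then show "(take i r @ unBr (r ! i) @ drop (Suc i) r, r) \<in> measure (size_list size)"
    by (simp add: s size_list_append)
qed simp

declare bracket_op.simps [simp del]

text \<open>The linear and bilinear extensions of \<open>bracket_op\<close> and of concatenation.\<close>

definition reynolds_op :: "('x bword \<Rightarrow>\<^sub>0 'k::field_char_0) \<Rightarrow> ('x bword \<Rightarrow>\<^sub>0 'k)"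
  where "reynolds_op p =
    (\<Sum>r \<in> Poly_Mapping.keys p. pm_smult (Poly_Mapping.lookup p r) (bracket_op r))"

definition concat_mult ::
    "('x bword \<Rightarrow>\<^sub>0 'k::field_char_0) \<Rightarrow> ('x bword \<Rightarrow>\<^sub>0 'k) \<Rightarrow> ('x bword \<Rightarrow>\<^sub>0 'k)"
  where "concat_mult p q =
    (\<Sum>u \<in> Poly_Mapping.keys p. \<Sum>v \<in> Poly_Mapping.keys q.
      Poly_Mapping.single (u @ v) (Poly_Mapping.lookup p u * Poly_Mapping.lookup q v))"

definition reynolds_word_algebra :: "'x set \<Rightarrow> ('k::field_char_0, 'x bword \<Rightarrow>\<^sub>0 'k) module"
  where "reynolds_word_algebra V =
    \<lparr>carrier = {p. Poly_Mapping.keys p \<subseteq> reynolds_words V},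
     monoid.mult = concat_mult,
     one = Poly_Mapping.single [] 1,
     ring.zero = 0,
     add = (+),
     module.smult = pm_smult\<rparr>"

definition generator :: "'x \<Rightarrow> ('x bword \<Rightarrow>\<^sub>0 'k::field_char_0)"
  where "generator x = Poly_Mapping.single [Var x] 1"

end

(*
  The recursion defining P on a product w of m bracketed letters reads
  m P(w) = P(w) + P(D w) - w, where D w is the sum of the words obtained by removing the bracket
  of one letter (for nested brackets: one layer); D obeys the Leibniz rule D(uv) = D(u) v + u D(v).
  Induction on v extends this from v = [w] to
  m P(u P(v)) = P(D(u) P(v)) + P(uv) - u P(v) for u a product of m >= 1 bracketed letters, and
  the Reynolds identity for words follows by induction on the total size.  It holds for all
  bracketed words; restricting to Reynolds words matters only for uniqueness.
  Conversely, in any Reynolds algebra the Reynolds identity forces the same recursion on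
  products Q(a_1) ... Q(a_m), so evaluating words commutes with the operators.
*)

theory Submission
  imports Defs
begin

section \<open>The word algebra and its operator\<close>

text \<open>Makes \<open>\<Rightarrow>\<^sub>0\<close> over words a \<open>ring_1\<close> whose product is \<open>concat_mult\<close>.\<close>

instantiation list :: (type) monoid_add
begin

definition zero_list :: "'a list" where "zero_list = []"

definition plus_list :: "'a list \<Rightarrow> 'a list \<Rightarrow> 'a list" where "plus_list = (@)"

instance
  by standard (simp_all add: zero_list_def plus_list_def)

end

section \<open>Words as a basis, and scalars as multiples of the empty word\<close>

abbreviation word :: "'x bword \<Rightarrow> ('x bword \<Rightarrow>\<^sub>0 'k::field_char_0)"
  where "word w \<equiv> Poly_Mapping.single w 1"

lemma word_mult: "word u * word v = word (u @ v)"
  by (simp add: mult_single plus_list_def)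

lemma one_eq_word: "1 = word []"
  by (metis single_one zero_list_def)

lemma word_Nil_mult [simp]: "word [] * p = p" "p * word [] = p"
  by (simp_all flip: one_eq_word)

lemma scalar_mult_single:
  "Poly_Mapping.single [] c * Poly_Mapping.single w d = Poly_Mapping.single w (c * d)"
  by (simp add: mult_single plus_list_def)

text \<open>Turns scaling into multiplication by a multiple of the unit, so that the linear algebra
  below becomes computation inside one ring, where these scalars are central.\<close>

lemma pm_smult_eq: "pm_smult c p = Poly_Mapping.single [] c * p" for p :: "'x bword \<Rightarrow>\<^sub>0 'k::field_char_0"
  using mult_map_scale_conv_mult[of c p] by (simp add: zero_list_def)

lemma sum_single_keys: "(\<Sum>w\<in>Poly_Mapping.keys p. Poly_Mapping.single w (Poly_Mapping.lookup p w)) = p"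
  by (rule poly_mapping_eqI)
    (auto simp: lookup_sum lookup_single when_def in_keys_iff sum.delta[OF finite_keys])

lemma scalar_commute:
  fixes p :: "'x bword \<Rightarrow>\<^sub>0 'k::field_char_0"
  shows "Poly_Mapping.single [] c * p = p * Poly_Mapping.single [] c"
proof -
  have "Poly_Mapping.single [] c * (\<Sum>w\<in>Poly_Mapping.keys p. Poly_Mapping.single w (Poly_Mapping.lookup p w))
    = (\<Sum>w\<in>Poly_Mapping.keys p. Poly_Mapping.single w (Poly_Mapping.lookup p w)) * Poly_Mapping.single [] c"
    by (simp add: sum_distrib_left sum_distrib_right mult_single plus_list_def mult.commute)
  then show ?thesis
    by (simp add: sum_single_keys)
qed

lemma concat_mult_eq: "concat_mult p q = p * q"
proof -
  have "concat_mult p q =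
      (\<Sum>w\<in>Poly_Mapping.keys p. Poly_Mapping.single w (Poly_Mapping.lookup p w)) *
      (\<Sum>w\<in>Poly_Mapping.keys q. Poly_Mapping.single w (Poly_Mapping.lookup q w))"
    unfolding concat_mult_def sum_product by (simp add: mult_single plus_list_def)
  then show ?thesis by (simp add: sum_single_keys)
qed

lemma of_nat_eq_scalar: "of_nat n = Poly_Mapping.single ([]::'x bword) (of_nat n :: 'k::field_char_0)"
  using single_of_nat[of n, where 'a="'x bword" and 'b='k] by (simp add: zero_list_def)

text \<open>Characteristic zero enters here: \<open>of_nat n\<close> is a scalar multiple of the
  unit with an inverse in the field. This removes the factors \<open>length u - 1\<close> and
  \<open>length v - 1\<close> that the inductions below produce.\<close>

lemma of_nat_mult_cancel:
  fixes p q :: "'x bword \<Rightarrow>\<^sub>0 'k::field_char_0"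
  assumes "of_nat n * p = of_nat n * q" and "n \<noteq> 0"
  shows "p = q"
proof -
  have "Poly_Mapping.single [] (1 / of_nat n :: 'k) * (of_nat n * p) =
      Poly_Mapping.single [] (1 / of_nat n) * (of_nat n * q)"
    using assms by simp
  then show ?thesis
    using \<open>n \<noteq> 0\<close>
    by (simp add: of_nat_eq_scalar mult.assoc[symmetric] scalar_mult_single)
qed

section \<open>The linear extension of the bracket operator\<close>

lemma reynolds_op_superset:
  assumes "finite S" "Poly_Mapping.keys p \<subseteq> S"
  shows "reynolds_op p =
    (\<Sum>r\<in>S. Poly_Mapping.single [] (Poly_Mapping.lookup p r) * bracket_op r)"
  unfolding reynolds_op_def pm_smult_eq
  by (rule sum.mono_neutral_left) (use assms in \<open>auto simp: in_keys_iff\<close>)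

lemma reynolds_op_add: "reynolds_op (p + q) = reynolds_op p + reynolds_op q"
proof -
  define S where "S = Poly_Mapping.keys p \<union> Poly_Mapping.keys q"
  have S: "finite S" "Poly_Mapping.keys p \<subseteq> S" "Poly_Mapping.keys q \<subseteq> S"
      "Poly_Mapping.keys (p + q) \<subseteq> S"
    using keys_add[of p q] by (auto simp: S_def)
  show ?thesis
    by (simp add: reynolds_op_superset[OF S(1,2)] reynolds_op_superset[OF S(1,3)]
        reynolds_op_superset[OF S(1,4)] lookup_add single_add distrib_right sum.distrib)
qed

lemma reynolds_op_single:
  "reynolds_op (Poly_Mapping.single w c) = Poly_Mapping.single [] c * bracket_op w"
  by (subst reynolds_op_superset[of "{w}"]) auto

lemma reynolds_op_word: "reynolds_op (word w) = bracket_op w"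
  by (simp add: reynolds_op_single)

interpretation op: additive reynolds_op
  by standard (rule reynolds_op_add)

lemma reynolds_op_scalar:
  "reynolds_op (Poly_Mapping.single [] c * p) = Poly_Mapping.single [] c * reynolds_op p"
proof -
  have "reynolds_op (Poly_Mapping.single [] c * (\<Sum>w\<in>Poly_Mapping.keys p. Poly_Mapping.single w (Poly_Mapping.lookup p w)))
   = Poly_Mapping.single [] c * reynolds_op (\<Sum>w\<in>Poly_Mapping.keys p. Poly_Mapping.single w (Poly_Mapping.lookup p w))"
    by (simp add: sum_distrib_left op.sum mult_single plus_list_def reynolds_op_single
        mult.assoc[symmetric])
  then show ?thesis by (simp add: sum_single_keys)
qed

lemma reynolds_op_of_nat: "reynolds_op (of_nat n * p) = of_nat n * reynolds_op p"
  by (simp add: of_nat_eq_scalar reynolds_op_scalar)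

text \<open>The sum of the splices in \<open>bracket_op\<close>, arranged so that the Leibniz rule is an easy induction.\<close>

fun bracket_deriv :: "'x bword \<Rightarrow> ('x bword \<Rightarrow>\<^sub>0 'k::field_char_0)"
  where "bracket_deriv [] = 0"
  | "bracket_deriv (a # w) = word (unBr a @ w) + word [a] * bracket_deriv w"

lemma bracket_deriv_sum:
  "bracket_deriv w = (\<Sum>i<length w. word (take i w @ unBr (w ! i) @ drop (Suc i) w))"
proof (induction w)
  case (Cons a w)
  show ?case
    by (simp add: Cons.IH sum.lessThan_Suc_shift sum_distrib_left word_mult del: sum.lessThan_Suc)
qed simp

lemma bracket_deriv_append:
  "(bracket_deriv (u @ v) :: 'x bword \<Rightarrow>\<^sub>0 'k::field_char_0) = bracket_deriv u * word v + word u * bracket_deriv v"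
proof (induction u)
  case Nil
  show ?case by simp
next
  case (Cons a u)
  have "(word (a # u) :: 'x bword \<Rightarrow>\<^sub>0 'k) = word [a] * word u" by (simp add: word_mult)
  then have "word (a # u) * (bracket_deriv v :: 'x bword \<Rightarrow>\<^sub>0 'k) = word [a] * (word u * bracket_deriv v)"
    by (simp only: mult.assoc)
  then show ?case
    by (simp add: Cons.IH distrib_left distrib_right word_mult mult.assoc)
qed

text \<open>The defining recursion with its denominator cleared. The factor \<open>length w\<close>
  in place of \<open>length w - 1\<close> is additive under concatenation, which matches the Leibniz
  rule.\<close>

lemma reynolds_op_bracket_product:
  assumes "bracket_product w"
  shows "of_nat (length w) * reynolds_op (word w) =
    (reynolds_op (word w) :: 'x bword \<Rightarrow>\<^sub>0 'k::field_char_0) + reynolds_op (bracket_deriv w) - word w"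
proof -
  have "length w \<ge> 2" using assms by (auto simp: bracket_product_def)
  then have n: "(of_nat (length w) :: 'x bword \<Rightarrow>\<^sub>0 'k) = 1 + of_nat (length w - 1)"
    by (simp add: of_nat_diff)
  have "reynolds_op (word w) = Poly_Mapping.single [] (1 / of_nat (length w - 1) :: 'k) *
      (reynolds_op (bracket_deriv w) - word w)"
    unfolding reynolds_op_word bracket_op.simps[of w]
    using assms by (simp add: bracket_deriv_sum op.sum pm_smult_eq reynolds_op_word)
  then have "of_nat (length w - 1) * reynolds_op (word w) = (of_nat (length w - 1) *
      Poly_Mapping.single [] (1 / of_nat (length w - 1) :: 'k)) * (reynolds_op (bracket_deriv w) - word w)"
    by (simp only: mult.assoc)
  also have "of_nat (length w - 1) * Poly_Mapping.single [] (1 / of_nat (length w - 1) :: 'k) = word []"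
    using \<open>length w \<ge> 2\<close> by (simp add: of_nat_eq_scalar scalar_mult_single)
  finally show ?thesis by (simp add: n distrib_right)
qed

lemma reynolds_op_bracket:
  "\<not> bracket_product w \<Longrightarrow> reynolds_op (word w) = word [Br w]"
  by (simp add: reynolds_op_word bracket_op.simps)

text \<open>Carries an induction hypothesis from the single splices to their sum. It is applied with
  \<open>G\<close> the defect of an identity, that is, the difference of its two sides.\<close>

lemma additive_bracket_deriv:
  assumes "additive G"
    and "\<And>i. i < length v \<Longrightarrow> G (word (take i v @ unBr (v ! i) @ drop (Suc i) v)) = 0"
  shows "G (bracket_deriv v) = 0"
  using assms(2) by (simp add: bracket_deriv_sum additive.sum[OF assms(1)])

text \<open>The measure for the inductions along the recursion. Length would not do, since the
  content of the removed bracket may have several letters.\<close>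

lemma size_bracket_splice:
  assumes "bracket_product v" "i < length v"
  shows "size_list size (take i v @ unBr (v ! i) @ drop (Suc i) v) < size_list size v"
proof -
  obtain s where s: "v ! i = Br s"
    using assms by (auto simp: bracket_product_def)
  have "size_list size v = size_list size (take i v @ v ! i # drop (Suc i) v)"
    using assms by (simp add: id_take_nth_drop[symmetric])
  then show ?thesis
    by (simp add: s size_list_append)
qed

lemma bracket_product_append:
  assumes "u = map Br us" "v = map Br vs" "us \<noteq> []" "vs \<noteq> []"
  shows "bracket_product (u @ v)"
  using assms
  by (auto simp: bracket_product_def Suc_le_eq neq_Nil_conv intro!: exI[of _ "us @ vs"])

lemma of_nat_mult_left: "p * (of_nat n * q) = of_nat n * (p * q)" for p q :: "'a::semiring_1"
  by (metis mult.assoc mult_of_nat_commute)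

text \<open>In general \<open>reynolds_op (word v)\<close> is not a word, so the recursion does not
  apply directly to \<open>word u * reynolds_op (word v)\<close>. The statement is what the
  recursion would give if \<open>reynolds_op (word v)\<close> were the letter \<open>Br v\<close>,
  and induction on \<open>v\<close> reduces to that case.\<close>

lemma reynolds_op_mult_op_right:
  assumes "u = map Br us" "us \<noteq> []"
  shows "of_nat (length u) * (reynolds_op (word u * reynolds_op (word v)) :: 'x bword \<Rightarrow>\<^sub>0 'k::field_char_0) =
    reynolds_op (bracket_deriv u * reynolds_op (word v)) + reynolds_op (word u * word v)
      - word u * reynolds_op (word v)"
proof (induction "size_list size v" arbitrary: v rule: less_induct)
  case less
  define P :: "('x bword \<Rightarrow>\<^sub>0 'k) \<Rightarrow> ('x bword \<Rightarrow>\<^sub>0 'k)" where "P = reynolds_op"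
  have P_add: "P (x + y) = P x + P y" for x y
    by (simp add: P_def reynolds_op_add)
  have P_diff: "P (x - y) = P x - P y" for x y
    by (simp add: P_def op.diff)
  define U V DU DV :: "'x bword \<Rightarrow>\<^sub>0 'k" where "U = word u" and "V = word v"
    and "DU = bracket_deriv u" and "DV = bracket_deriv v"
  define m n :: "'x bword \<Rightarrow>\<^sub>0 'k" where "m = of_nat (length u)" and "n = of_nat (length v)"
  \<comment> \<open>Concatenation is not commutative, so the centrality of \<open>n\<close> has to
    be supplied for the rewriting.\<close>
  have nc: "U * (n * z) = n * (U * z)" "DU * (n * z) = n * (DU * z)" "m * (n * z) = n * (m * z)" for z
    by (simp_all add: n_def of_nat_mult_left)
  have Pn: "P (n * z) = n * P z" "P (m * z) = m * P z" for z
    by (simp_all add: m_def n_def P_def reynolds_op_of_nat)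
  show ?case
  proof (cases "bracket_product v")
    case False
    then have Pv: "P (word v) = word [Br v]"
      by (simp add: P_def reynolds_op_bracket)
    \<comment> \<open>Here \<open>U * P V\<close> is a word of \<open>length u + 1\<close> bracketed
      letters. Its recursion is the claim, because \<open>bracket_deriv [Br v]\<close> is
      \<open>V\<close>.\<close>
    have "bracket_product (u @ [Br v])"
      by (rule bracket_product_append[of _ us _ "[v]"]) (use assms in auto)
    from reynolds_op_bracket_product[OF this, where 'k = 'k, folded P_def]
    have "(m + 1) * P (U * P V) = P (U * P V) + P (DU * P V + U * V) - U * P V"
      by (simp add: m_def U_def V_def DU_def Pv word_mult bracket_deriv_append
          flip: one_eq_word add.commute)
    then have "m * P (U * P V) = P (DU * P V) + P (U * V) - U * P V"
      by (simp add: algebra_simps P_add)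
    then show ?thesis
      by (simp add: P_def m_def U_def V_def DU_def)
  next
    case True
    \<comment> \<open>The defect of the claim as a function of the inner argument. It vanishes on
      each splice of \<open>v\<close> by induction, hence on \<open>DV\<close>.\<close>
    define G where "G z = m * P (U * P z) - P (DU * P z) - P (U * z) + U * P z" for z
    have "additive G"
      by standard (simp add: G_def P_add algebra_simps)
    moreover have "G (word (take i v @ unBr (v ! i) @ drop (Suc i) v)) = 0" if "i < length v" for i
      using less[OF size_bracket_splice[OF True that]]
      by (simp add: G_def P_def m_def U_def DU_def)
    ultimately have "G DV = 0"
      unfolding DV_def by (rule additive_bracket_deriv)
    then have IH: "m * P (U * P DV) = P (DU * P DV) + P (U * DV) - U * P DV"
      by (simp add: G_def algebra_simps)
    from True obtain vs where vs: "v = map Br vs" "length vs \<ge> 2"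
      by (auto simp: bracket_product_def)
    then have "vs \<noteq> []" by auto
    \<comment> \<open>The recursion for the concatenation, its derivative split by the Leibniz rule.
      Together with \<open>PV\<close>, which says that \<open>P DV\<close> is
      \<open>(n - 1) * P V + V\<close>, it eliminates \<open>DV\<close> from
      \<open>IH\<close>.\<close>
    from reynolds_op_bracket_product[OF bracket_product_append[OF assms(1) vs(1) assms(2) this],
        where 'k = 'k, folded P_def]
    have UV: "(m + n) * P (U * V) = P (U * V) + (P (DU * V) + P (U * DV)) - U * V"
      by (simp add: m_def n_def U_def V_def DU_def DV_def word_mult bracket_deriv_append P_add)
    from reynolds_op_bracket_product[OF True, where 'k = 'k, folded P_def]
    have PV: "P DV = n * P V - P V + V"
      by (simp add: n_def V_def DV_def algebra_simps)
    \<comment> \<open>After the substitution the terms \<open>P (DU * V)\<close> and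
      \<open>U * V\<close> cancel. What is left is \<open>n - 1\<close> times the claim, and
      \<open>length v\<close> is at least 2.\<close>
    have "(n - 1) * (m * P (U * P V)) = (n - 1) * (P (DU * P V) + P (U * V) - U * P V)"
    proof -
      have a: "(n - 1) * (m * P (U * P V)) = m * P (U * P DV) - m * P (U * V)"
        unfolding PV
        by (simp add: distrib_left left_diff_distrib right_diff_distrib nc P_add P_diff Pn)
      have b: "P (DU * P DV) = (n - 1) * P (DU * P V) + P (DU * V)"
        unfolding PV
        by (simp add: distrib_left left_diff_distrib right_diff_distrib nc P_add P_diff Pn)
      have c: "U * P DV = (n - 1) * (U * P V) + U * V"
        unfolding PV by (simp add: distrib_left left_diff_distrib right_diff_distrib nc)
      have d: "P (U * DV) = (m + n) * P (U * V) - P (U * V) - P (DU * V) + U * V"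
        unfolding UV by simp
      show ?thesis
        unfolding a IH unfolding b c d
        by (simp add: distrib_left distrib_right left_diff_distrib right_diff_distrib)
    qed
    moreover have "n - 1 = of_nat (length v - 1)"
      using vs by (simp add: n_def of_nat_diff)
    moreover have "length v - 1 \<noteq> 0"
      using vs by simp
    ultimately have "m * P (U * P V) = P (DU * P V) + P (U * V) - U * P V"
      by (metis of_nat_mult_cancel)
    then show ?thesis
      by (simp add: P_def m_def U_def V_def DU_def)
  qed
qed

section \<open>The Reynolds identity\<close>

text \<open>The case distinction is not symmetric. If \<open>u\<close> is a bracket product,
  \<open>reynolds_op_mult_op_right\<close> controls the term
  \<open>word u * reynolds_op (word v)\<close>. Otherwise \<open>reynolds_op (word u)\<close> is a
  single letter, and the recursion applies directly to products that start with it.\<close>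

lemma reynolds_op_identity_word:
  "reynolds_op (word u) * reynolds_op (word v) =
    (reynolds_op (word u * reynolds_op (word v)) + reynolds_op (reynolds_op (word u) * word v)
      - reynolds_op (reynolds_op (word u) * reynolds_op (word v)) :: 'x bword \<Rightarrow>\<^sub>0 'k::field_char_0)"
proof (induction "size_list size u + size_list size v" arbitrary: u v rule: less_induct)
  case less
  define P :: "('x bword \<Rightarrow>\<^sub>0 'k) \<Rightarrow> ('x bword \<Rightarrow>\<^sub>0 'k)" where "P = reynolds_op"
  have P_add: "P (x + y) = P x + P y" for x y
    by (simp add: P_def reynolds_op_add)
  have P_diff: "P (x - y) = P x - P y" for x y
    by (simp add: P_def op.diff)
  have P_nat: "P (of_nat k * z) = of_nat k * P z" for k z
    by (simp add: P_def reynolds_op_of_nat)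
  \<comment> \<open>The defect of the Reynolds identity. Additivity in each argument lets its
    vanishing on smaller words pass to \<open>DU\<close> and \<open>DV\<close>.\<close>
  define G where "G y z = P y * P z - P (y * P z) - P (P y * z) + P (P y * P z)" for y z
  have G_add: "additive (G y)" "additive (\<lambda>z. G z y)" for y
    unfolding additive_def by (simp_all add: G_def P_add algebra_simps)
  have G0: "G y z = 0" if "P y * P z = P (y * P z) + P (P y * z) - P (P y * P z)" for y z
  proof -
    have "G y z = P y * P z - (P (y * P z) + P (P y * z) - P (P y * P z))"
      by (simp add: G_def)
    also have "\<dots> = 0"
      unfolding right_minus_eq by (rule that)
    finally show ?thesis .
  qed
  define U V DU DV :: "'x bword \<Rightarrow>\<^sub>0 'k" where "U = word u" and "V = word v"
    and "DU = bracket_deriv u" and "DV = bracket_deriv v"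
  define m n :: "'x bword \<Rightarrow>\<^sub>0 'k" where "m = of_nat (length u)" and "n = of_nat (length v)"
  have Pn: "P (n * z) = n * P z" "P (m * z) = m * P z" for z
    by (simp_all add: m_def n_def P_nat)
  have nc: "y * (n * z) = n * (y * z)" for y z
    by (simp add: n_def of_nat_mult_left)
  have "G U V = 0"
  proof (cases "bracket_product u")
    case True
    then obtain us where us: "u = map Br us" "length us \<ge> 2"
      by (auto simp: bracket_product_def)
    then have "us \<noteq> []" by auto
    from reynolds_op_mult_op_right[OF us(1) this, of v, where 'k = 'k]
    have UV: "m * P (U * P V) = P (DU * P V) + P (U * V) - U * P V"
      by (simp add: P_def m_def U_def V_def DU_def)
    have "G DU V = 0"
      unfolding DU_def
    proof (rule additive_bracket_deriv[OF G_add(2)])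
      fix i assume "i < length u"
      from less[of "take i u @ unBr (u ! i) @ drop (Suc i) u" v] size_bracket_splice[OF True this]
      show "G (word (take i u @ unBr (u ! i) @ drop (Suc i) u)) V = 0"
        by (intro G0) (simp add: P_def V_def)
    qed
    moreover have PU: "P DU = m * P U - P U + U"
      using reynolds_op_bracket_product[OF True, where 'k = 'k]
      by (simp add: P_def m_def U_def DU_def algebra_simps)
    ultimately have "P (DU * P V) = (m * P U - P U + U) * P V - P ((m * P U - P U + U) * V)
        + P ((m * P U - P U + U) * P V)"
      by (simp add: G_def algebra_simps)
    \<comment> \<open>One of two expressions for \<open>P (DU * P V)\<close>: it comes from
      \<open>G DU V = 0\<close> with \<open>P DU = (m - 1) * P U + U\<close>. The other is
      \<open>UV\<close>, and they differ by \<open>(m - 1) * G U V\<close>.\<close>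
    then have "P (DU * P V) = (m - 1) * G U V + m * P (U * P V) - P (U * V) + U * P V"
      by (simp add: G_def distrib_left distrib_right left_diff_distrib right_diff_distrib
          mult.assoc Pn P_add P_diff)
    then have "(m - 1) * G U V = 0"
      using UV by (simp add: algebra_simps)
    moreover have "m - 1 = of_nat (length u - 1)" "length u - 1 \<noteq> 0"
      using us by (simp_all add: m_def of_nat_diff)
    ultimately show ?thesis
      by (metis mult_zero_right of_nat_mult_cancel)
  next
    case False
    then have Pu: "P U = word [Br u]"
      by (simp add: P_def U_def reynolds_op_bracket)
    show ?thesis
    proof (cases "bracket_product v")
      case True
      then obtain vs where vs: "v = map Br vs" "length vs \<ge> 2"
        by (auto simp: bracket_product_def)
      \<comment> \<open>As \<open>P U\<close> is one letter, \<open>P U * V\<close> is a word of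
        \<open>length v + 1\<close> bracketed letters. Its recursion takes the place of
        \<open>reynolds_op_mult_op_right\<close>.\<close>
      then have "bracket_product ([Br u] @ v)"
        by (intro bracket_product_append[of _ "[u]" _ vs]) auto
      from reynolds_op_bracket_product[OF this, where 'k = 'k]
      have "(1 + n) * P (P U * V) = P (P U * V) + P (U * V + P U * DV) - P U * V"
        unfolding Pu by (simp add: P_def n_def U_def V_def DV_def word_mult)
      then have UV: "P (P U * DV) = n * P (P U * V) - P (U * V) + P U * V"
        by (simp add: P_add algebra_simps)
      have "G U DV = 0"
        unfolding DV_def
      proof (rule additive_bracket_deriv[OF G_add(1)])
        fix i assume "i < length v"
        from less[of u "take i v @ unBr (v ! i) @ drop (Suc i) v"] size_bracket_splice[OF True this]
        show "G U (word (take i v @ unBr (v ! i) @ drop (Suc i) v)) = 0"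
          by (intro G0) (simp add: P_def U_def)
      qed
      moreover have PV: "P DV = n * P V - P V + V"
        using reynolds_op_bracket_product[OF True, where 'k = 'k]
        by (simp add: P_def n_def V_def DV_def algebra_simps)
      ultimately have "P (P U * DV) = P U * (n * P V - P V + V) - P (U * (n * P V - P V + V))
          + P (P U * (n * P V - P V + V))"
        by (simp add: G_def algebra_simps)
      then have "P (P U * DV) = (n - 1) * G U V + n * P (P U * V) - P (U * V) + P U * V"
        by (simp add: G_def distrib_left distrib_right left_diff_distrib right_diff_distrib
            nc Pn P_add P_diff)
      then have "(n - 1) * G U V = 0"
        using UV by (simp add: algebra_simps)
      moreover have "n - 1 = of_nat (length v - 1)" "length v - 1 \<noteq> 0"
        using vs by (simp_all add: n_def of_nat_diff)
      ultimately show ?thesis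
        by (metis mult_zero_right of_nat_mult_cancel)
    next
      case False
      then have Pv: "P V = word [Br v]"
        by (simp add: P_def V_def reynolds_op_bracket)
      \<comment> \<open>For two letters the recursion is the Reynolds identity itself: its
        denominator is 1, and removing one bracket turns \<open>P U * P V\<close> into
        \<open>U * P V\<close> or \<open>P U * V\<close>.\<close>
      have "bracket_product [Br u, Br v]"
        unfolding bracket_product_def by (rule exI[of _ "[u, v]"]) simp
      from reynolds_op_bracket_product[OF this, where 'k = 'k]
      have "2 * P (P U * P V) = P (P U * P V) + P (U * P V + P U * V) - P U * P V"
        unfolding Pu Pv by (simp add: P_def U_def V_def word_mult)
      then show ?thesis
        by (simp add: G_def P_add mult_2 algebra_simps)
    qed
  qed
  then show ?case
    by (simp add: G_def P_def U_def V_def algebra_simps)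
qed

text \<open>Linear induction confined to combinations supported on \<open>S\<close>, so that
  membership in the carrier is available in each step. The proof carries the support of the partial
  sums along for the \<open>add\<close> case.\<close>

lemma poly_mapping_span_induct [consumes 1, case_names zero add single]:
  fixes p :: "'a \<Rightarrow>\<^sub>0 'b::comm_monoid_add"
  assumes "Poly_Mapping.keys p \<subseteq> S"
    and "Q 0"
    and "\<And>p q. Poly_Mapping.keys p \<subseteq> S \<Longrightarrow> Poly_Mapping.keys q \<subseteq> S \<Longrightarrow> Q p \<Longrightarrow> Q q \<Longrightarrow> Q (p + q)"
    and "\<And>w c. w \<in> S \<Longrightarrow> Q (Poly_Mapping.single w c)"
  shows "Q p"
proof -
  have "Poly_Mapping.keys (\<Sum>w\<in>A. Poly_Mapping.single w (Poly_Mapping.lookup p w)) \<subseteq> S \<and>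
      Q (\<Sum>w\<in>A. Poly_Mapping.single w (Poly_Mapping.lookup p w))" if "finite A" "A \<subseteq> S" for A
    using that
  proof (induction A)
    case (insert w A)
    then show ?case
      using keys_add[of "Poly_Mapping.single w (Poly_Mapping.lookup p w)"
          "\<Sum>w\<in>A. Poly_Mapping.single w (Poly_Mapping.lookup p w)"]
      by (auto intro!: assms(3,4) split: if_splits)
  qed (use assms(2) in simp)
  from this[OF finite_keys assms(1)] show ?thesis
    by (simp add: sum_single_keys)
qed

lemma single_eq_scalar_mult_word: "Poly_Mapping.single w c = Poly_Mapping.single [] c * word w"
  by (simp add: scalar_mult_single)

text \<open>Both sides are linear in each argument, so the identity for words extends, first in
  \<open>q\<close> with a word on the left and then in \<open>p\<close>.\<close>

lemma reynolds_op_identity: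
  "reynolds_op p * reynolds_op q =
    reynolds_op (p * reynolds_op q) + reynolds_op (reynolds_op p * q)
      - reynolds_op (reynolds_op p * reynolds_op (q :: 'x bword \<Rightarrow>\<^sub>0 'k::field_char_0))"
proof -
  have w: "reynolds_op (word u) * reynolds_op q =
      reynolds_op (word u * reynolds_op q) + reynolds_op (reynolds_op (word u) * q)
      - reynolds_op (reynolds_op (word u) * reynolds_op q)"
    for u and q :: "'x bword \<Rightarrow>\<^sub>0 'k"
  proof (rule poly_mapping_span_induct[where p = q and S = UNIV])
    fix v :: "'x bword" and c :: 'k
    have "y * (Poly_Mapping.single [] c * z) = Poly_Mapping.single [] c * (y * z)"
      for y z :: "'x bword \<Rightarrow>\<^sub>0 'k"
      by (metis mult.assoc scalar_commute)
    then show "reynolds_op (word u) * reynolds_op (Poly_Mapping.single v c) =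
      reynolds_op (word u * reynolds_op (Poly_Mapping.single v c)) +
      reynolds_op (reynolds_op (word u) * Poly_Mapping.single v c)
      - reynolds_op (reynolds_op (word u) * reynolds_op (Poly_Mapping.single v c))"
      unfolding single_eq_scalar_mult_word[of v c]
      by (simp add: reynolds_op_scalar flip: reynolds_op_identity_word distrib_left right_diff_distrib)
  qed (simp_all add: op.zero reynolds_op_add algebra_simps)
  show ?thesis
  proof (rule poly_mapping_span_induct[where p = p and S = UNIV])
    fix u :: "'x bword" and c :: 'k
    show "reynolds_op (Poly_Mapping.single u c) * reynolds_op q =
      reynolds_op (Poly_Mapping.single u c * reynolds_op q) +
      reynolds_op (reynolds_op (Poly_Mapping.single u c) * q)
      - reynolds_op (reynolds_op (Poly_Mapping.single u c) * reynolds_op q)"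
      unfolding single_eq_scalar_mult_word[of u c]
      by (simp add: reynolds_op_scalar mult.assoc flip: w distrib_left right_diff_distrib)
  qed (simp_all add: op.zero reynolds_op_add algebra_simps)
qed

section \<open>Reynolds words\<close>

text \<open>The pattern that Reynolds words avoid is a single letter, so an occurrence in a nonempty
  word is the head, lies inside the bracket of the head, or lies in the tail. This makes membership
  recursive.\<close>

lemma subword_singleton_Cons:
  "subword [b] (a # w) \<longleftrightarrow> a = b \<or> (\<exists>v. a = Br v \<and> subword [b] v) \<or> subword [b] w"
proof
  assume "subword [b] (a # w)"
  then show "a = b \<or> (\<exists>v. a = Br v \<and> subword [b] v) \<or> subword [b] w"
  proof cases
    case (here x y)
    then show ?thesis
      using subword.here[of "[b]" "tl x" y] by (cases x) auto
  next
    case (inside v x y)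
    then show ?thesis
      using subword.inside[of "[b]" v "tl x" y] by (cases x) auto
  qed
next
  have "subword [b] (a # w)" if "subword [b] w"
    using that
  proof cases
    case (here x y)
    then show ?thesis
      using subword.here[of "[b]" "a # x" y] by simp
  next
    case (inside v x y)
    then show ?thesis
      using subword.inside[of "[b]" v "a # x" y] by simp
  qed
  then show "a = b \<or> (\<exists>v. a = Br v \<and> subword [b] v) \<or> subword [b] w \<Longrightarrow> subword [b] (a # w)"
    using subword.here[of "[b]" "[]" w] subword.inside[of "[b]" _ "[]" w] by auto
qed

lemma Nil_in_reynolds_words [simp]: "[] \<in> reynolds_words V"
  by (auto simp: reynolds_words_def intro: bracketed_words.Nil elim: subword.cases)

lemma Var_Cons_in_reynolds_words [simp]:
  "Var x # w \<in> reynolds_words V \<longleftrightarrow> x \<in> V \<and> w \<in> reynolds_words V"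
  by (auto simp: reynolds_words_def subword_singleton_Cons
      intro: bracketed_words.Var elim: bracketed_words.cases)

lemma Br_Cons_in_reynolds_words [simp]:
  "Br u # w \<in> reynolds_words V \<longleftrightarrow>
    u \<in> reynolds_words V \<and> \<not> bracket_product u \<and> w \<in> reynolds_words V"
  by (auto simp: reynolds_words_def subword_singleton_Cons
      intro: bracketed_words.Br elim: bracketed_words.cases)

lemma append_in_reynolds_words [simp]:
  "u @ w \<in> reynolds_words V \<longleftrightarrow> u \<in> reynolds_words V \<and> w \<in> reynolds_words V"
proof (induction u)
  case (Cons a u)
  then show ?case by (cases a) auto
qed simp

lemma splice_in_reynolds_words:
  assumes "bracket_product w" "w \<in> reynolds_words V" "i < length w"
  shows "take i w @ unBr (w ! i) @ drop (Suc i) w \<in> reynolds_words V"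
proof -
  obtain s where s: "w ! i = Br s"
    using assms by (auto simp: bracket_product_def)
  have "take i w @ w ! i # drop (Suc i) w \<in> reynolds_words V"
    using assms by (simp add: id_take_nth_drop[symmetric])
  then show ?thesis
    by (simp add: s)
qed

lemma keys_sum_subset:
  assumes "\<And>i. i \<in> I \<Longrightarrow> Poly_Mapping.keys (f i) \<subseteq> S"
  shows "Poly_Mapping.keys (sum f I) \<subseteq> S"
  using keys_sum[of f I] assms by blast

lemma keys_scalar_mult:
  "Poly_Mapping.keys (Poly_Mapping.single [] c * p) \<subseteq> Poly_Mapping.keys (p :: 'x bword \<Rightarrow>\<^sub>0 'k::field_char_0)"
  using keys_mult[of "Poly_Mapping.single [] c" p] by (auto simp: plus_list_def split: if_splits)

text \<open>The recursion removes brackets, which keeps a word a Reynolds word, and adds one only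
  around a word that is not a bracket product, so the forbidden pattern never arises.\<close>

lemma keys_bracket_op:
  assumes "w \<in> reynolds_words V"
  shows "Poly_Mapping.keys (bracket_op w :: 'x bword \<Rightarrow>\<^sub>0 'k::field_char_0) \<subseteq> reynolds_words V"
  using assms
proof (induction "size_list size w" arbitrary: w rule: less_induct)
  case less
  show ?case
  proof (cases "bracket_product w")
    case True
    have "Poly_Mapping.keys (\<Sum>i<length w. bracket_op (take i w @ unBr (w ! i) @ drop (Suc i) w)
        :: 'x bword \<Rightarrow>\<^sub>0 'k) \<subseteq> reynolds_words V"
    proof (rule keys_sum_subset)
      fix i assume "i \<in> {..<length w}"
      then have i: "i < length w" by simp
      show "Poly_Mapping.keys (bracket_op (take i w @ unBr (w ! i) @ drop (Suc i) w)
          :: 'x bword \<Rightarrow>\<^sub>0 'k) \<subseteq> reynolds_words V"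
        by (rule less(1)[OF size_bracket_splice[OF True i] splice_in_reynolds_words[OF True less(2) i]])
    qed
    then have "Poly_Mapping.keys ((\<Sum>i<length w. bracket_op (take i w @ unBr (w ! i) @ drop (Suc i) w))
        - word w :: 'x bword \<Rightarrow>\<^sub>0 'k) \<subseteq> reynolds_words V"
      using less(2) by (auto simp: in_keys_iff lookup_minus lookup_single when_def split: if_splits)
    then show ?thesis
      using True keys_scalar_mult by (fastforce simp: bracket_op.simps[of w] pm_smult_eq)
  next
    case False
    then show ?thesis
      using less(2) by (simp add: bracket_op.simps[of w])
  qed
qed

lemma keys_reynolds_op:
  assumes "Poly_Mapping.keys p \<subseteq> reynolds_words V"
  shows "Poly_Mapping.keys (reynolds_op p) \<subseteq> reynolds_words V"
  unfolding reynolds_op_def pm_smult_eq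
proof (rule keys_sum_subset)
  fix w assume "w \<in> Poly_Mapping.keys p"
  then have "Poly_Mapping.keys (bracket_op w :: 'a bword \<Rightarrow>\<^sub>0 'b) \<subseteq> reynolds_words V"
    using assms by (intro keys_bracket_op) auto
  then show "Poly_Mapping.keys (Poly_Mapping.single [] (Poly_Mapping.lookup p w) * bracket_op w)
      \<subseteq> reynolds_words V"
    using keys_scalar_mult by blast
qed

lemma keys_add_reynolds_words:
  assumes "Poly_Mapping.keys p \<subseteq> reynolds_words V" "Poly_Mapping.keys q \<subseteq> reynolds_words V"
  shows "Poly_Mapping.keys (p + q) \<subseteq> reynolds_words V"
  using keys_add[of p q] assms by blast

lemma keys_mult_reynolds_words:
  assumes "Poly_Mapping.keys p \<subseteq> reynolds_words V" "Poly_Mapping.keys q \<subseteq> reynolds_words V"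
  shows "Poly_Mapping.keys (p * q) \<subseteq> reynolds_words V"
  using keys_mult[of p q] assms by (fastforce simp: plus_list_def)

section \<open>The Reynolds algebra on the span of the Reynolds words\<close>

lemma reynolds_word_algebra_simps [simp]:
  "carrier (reynolds_word_algebra V) = {p. Poly_Mapping.keys p \<subseteq> reynolds_words V}"
  "monoid.mult (reynolds_word_algebra V) p q = p * q"
  "one (reynolds_word_algebra V) = 1"
  "ring.zero (reynolds_word_algebra V) = 0"
  "add (reynolds_word_algebra V) p q = p + q"
  "module.smult (reynolds_word_algebra V) c p = Poly_Mapping.single [] c * p"
  by (simp_all add: reynolds_word_algebra_def concat_mult_eq pm_smult_eq flip: one_eq_word)

lemma ring_of_type_algebra_simps [simp]:
  "carrier (ring_of_type_algebra :: 'k::comm_ring_1 ring) = UNIV"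
  "monoid.mult (ring_of_type_algebra :: 'k ring) a b = a * b"
  "one (ring_of_type_algebra :: 'k ring) = 1"
  "ring.zero (ring_of_type_algebra :: 'k ring) = 0"
  "add (ring_of_type_algebra :: 'k ring) a b = a + b"
  by (simp_all add: ring_of_type_algebra_def)

lemma scalar_mult_scalar_mult:
  "Poly_Mapping.single [] (a * b) * p = Poly_Mapping.single [] a * (Poly_Mapping.single [] b * p)"
  by (simp add: scalar_mult_single flip: mult.assoc)

lemma reynolds_algebra_reynolds_word_algebra:
  "reynolds_algebra (ring_of_type_algebra :: 'k::field_char_0 ring)
    (reynolds_word_algebra V :: ('k, 'x bword \<Rightarrow>\<^sub>0 'k) module) reynolds_op"
proof -
  define M where "M = (reynolds_word_algebra V :: ('k, 'x bword \<Rightarrow>\<^sub>0 'k) module)"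
  have uminus: "p \<in> carrier M \<Longrightarrow> - p \<in> carrier M" for p
    by (simp add: M_def)
  have add: "p \<in> carrier M \<Longrightarrow> q \<in> carrier M \<Longrightarrow> p + q \<in> carrier M" for p q
    using keys_add_reynolds_words[of p V q] by (simp add: M_def)
  have mult: "p \<in> carrier M \<Longrightarrow> q \<in> carrier M \<Longrightarrow> p * q \<in> carrier M" for p q
    using keys_mult_reynolds_words[of p V q] by (auto simp: M_def)
  have op_closed: "p \<in> carrier M \<Longrightarrow> reynolds_op p \<in> carrier M" for p
    using keys_reynolds_op[of p V] by (auto simp: M_def)
  interpret ring M
  proof (rule ringI)
    show "abelian_group M"
    proof (rule abelian_groupI)
      fix p assume "p \<in> carrier M"
      then show "\<exists>q\<in>carrier M. q \<oplus>\<^bsub>M\<^esub> p = \<zero>\<^bsub>M\<^esub>"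
        by (intro bexI[of _ "- p"]) (auto simp: M_def)
    qed (use add in \<open>auto simp: M_def\<close>)
    show "Group.monoid M"
      by (rule monoidI) (use mult in \<open>auto simp: M_def zero_list_def mult.assoc\<close>)
  qed (auto simp: M_def algebra_simps)
  \<comment> \<open>The subtraction of the record is defined through additive inverses in its
    carrier. On the carrier it agrees with the subtraction of the type.\<close>
  have minus: "p \<ominus>\<^bsub>M\<^esub> q = p - q" if "p \<in> carrier M" "q \<in> carrier M" for p q
  proof -
    have "p = (p - q) \<oplus>\<^bsub>M\<^esub> q" by (simp add: M_def)
    moreover have "p - q \<in> carrier M" using add[OF that(1) uminus[OF that(2)]] by simp
    ultimately show ?thesis using that by (metis add.inv_solve_right' a_minus_def)
  qed
  have "module (ring_of_type_algebra :: 'k ring) M"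
  proof (rule moduleI)
    fix a :: 'k and p assume "p \<in> carrier M"
    then show "a \<odot>\<^bsub>M\<^esub> p \<in> carrier M"
      using keys_scalar_mult[of a p] by (auto simp: M_def)
  qed (auto simp: M_def single_add algebra_simps scalar_mult_scalar_mult cring_from_type_algebra
      is_abelian_group[unfolded M_def])
  then interpret module "ring_of_type_algebra :: 'k ring" M .
  show ?thesis
    unfolding M_def[symmetric]
  proof (unfold_locales)
    fix u v assume uv: "u \<in> carrier M" "v \<in> carrier M"
    then have "reynolds_op u \<in> carrier M" "reynolds_op v \<in> carrier M"
      by (auto intro: op_closed)
    with uv have "reynolds_op (u * reynolds_op v) + reynolds_op (reynolds_op u * v) \<in> carrier M"
        "reynolds_op (reynolds_op u * reynolds_op v) \<in> carrier M"
      by (auto intro!: op_closed mult add)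
    from minus[OF this] reynolds_op_identity[of u v]
    show "reynolds_op u \<otimes>\<^bsub>M\<^esub> reynolds_op v = reynolds_op (u \<otimes>\<^bsub>M\<^esub> reynolds_op v)
        \<oplus>\<^bsub>M\<^esub> reynolds_op (reynolds_op u \<otimes>\<^bsub>M\<^esub> v) \<ominus>\<^bsub>M\<^esub> reynolds_op (reynolds_op u \<otimes>\<^bsub>M\<^esub> reynolds_op v)"
      by (simp add: M_def)
  next
    fix a :: 'k and x y assume "x \<in> carrier M" "y \<in> carrier M"
    show "a \<odot>\<^bsub>M\<^esub> (x \<otimes>\<^bsub>M\<^esub> y) = x \<otimes>\<^bsub>M\<^esub> (a \<odot>\<^bsub>M\<^esub> y)"
      by (simp add: M_def) (metis mult.assoc scalar_commute)
  qed (auto simp: M_def mult.assoc reynolds_op_add reynolds_op_scalar dest: keys_reynolds_op)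
qed

section \<open>Evaluation in a Reynolds algebra\<close>

text \<open>On Reynolds words these values are forced on every homomorphism that extends
  \<open>f\<close>; see \<open>reynolds_hom_eq_lin_eval\<close>.\<close>

fun word_eval :: "('k, 'a, 'm) module_scheme \<Rightarrow> ('a \<Rightarrow> 'a) \<Rightarrow> ('x \<Rightarrow> 'a) \<Rightarrow> 'x bword \<Rightarrow> 'a"
  where "word_eval A Q f [] = \<one>\<^bsub>A\<^esub>"
  | "word_eval A Q f (Var x # w) = f x \<otimes>\<^bsub>A\<^esub> word_eval A Q f w"
  | "word_eval A Q f (Br u # w) = Q (word_eval A Q f u) \<otimes>\<^bsub>A\<^esub> word_eval A Q f w"

text \<open>The induction rule of the nested datatype speaks of letters. The recursion of
  \<open>word_eval\<close> yields one that speaks of words only.\<close>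

lemma bword_induct [case_names Nil Var Br]:
  fixes w :: "'x bword"
  assumes "Q []"
    and "\<And>x w. Q w \<Longrightarrow> Q (Var x # w)"
    and "\<And>u w. Q u \<Longrightarrow> Q w \<Longrightarrow> Q (Br u # w)"
  shows "Q w"
  by (rule word_eval.induct[where P = "\<lambda>_ _ _. Q"]) (use assms in auto)

locale generator_map = reynolds_algebra "ring_of_type_algebra :: 'k::field_char_0 ring" A Q
  for A :: "('k::field_char_0, 'a) module" and Q +
  fixes V :: "'x set" and f :: "'x \<Rightarrow> 'a"
  assumes f_closed: "f \<in> V \<rightarrow> carrier A"
begin

abbreviation ev :: "'x bword \<Rightarrow> 'a" where "ev \<equiv> word_eval A Q f"

definition lin_eval :: "('x bword \<Rightarrow>\<^sub>0 'k) \<Rightarrow> 'a"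
  where "lin_eval p = (\<Oplus>\<^bsub>A\<^esub>w\<in>Poly_Mapping.keys p. Poly_Mapping.lookup p w \<odot>\<^bsub>A\<^esub> ev w)"

lemma Q_closed [simp]: "a \<in> carrier A \<Longrightarrow> Q a \<in> carrier A"
  using P_closed by blast

lemma smult_add_left: "a \<in> carrier A \<Longrightarrow> (c + d) \<odot>\<^bsub>A\<^esub> a = c \<odot>\<^bsub>A\<^esub> a \<oplus>\<^bsub>A\<^esub> d \<odot>\<^bsub>A\<^esub> a"
  using smult_l_distr[of c d a] by simp

lemma smult_smult: "a \<in> carrier A \<Longrightarrow> (c * d) \<odot>\<^bsub>A\<^esub> a = c \<odot>\<^bsub>A\<^esub> (d \<odot>\<^bsub>A\<^esub> a)"
  using smult_assoc1[of c d a] by simp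

lemma one_smult [simp]: "a \<in> carrier A \<Longrightarrow> 1 \<odot>\<^bsub>A\<^esub> a = a"
  using smult_one[of a] by simp

lemma zero_smult [simp]: "a \<in> carrier A \<Longrightarrow> 0 \<odot>\<^bsub>A\<^esub> a = \<zero>\<^bsub>A\<^esub>"
  using smult_l_null[of a] by simp

lemma smult_cancel:
  assumes "c \<odot>\<^bsub>A\<^esub> a = c \<odot>\<^bsub>A\<^esub> b" "c \<noteq> 0" "a \<in> carrier A" "b \<in> carrier A"
  shows "a = b"
proof -
  have "(1 / c * c) \<odot>\<^bsub>A\<^esub> a = (1 / c * c) \<odot>\<^bsub>A\<^esub> b"
    using assms by (simp only: smult_smult)
  then show ?thesis using assms by simp
qed

lemma Q_zero: "Q \<zero>\<^bsub>A\<^esub> = \<zero>\<^bsub>A\<^esub>"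
  using P_smult[of 0 "\<zero>\<^bsub>A\<^esub>"] by simp

text \<open>Without subtraction, rearrangement and cancellation in the abelian group suffice for the
  computation in \<open>Q_product_step\<close>.\<close>

lemma reynolds_identity_add:
  assumes "u \<in> carrier A" "v \<in> carrier A"
  shows "Q u \<otimes>\<^bsub>A\<^esub> Q v \<oplus>\<^bsub>A\<^esub> Q (Q u \<otimes>\<^bsub>A\<^esub> Q v) = Q (u \<otimes>\<^bsub>A\<^esub> Q v) \<oplus>\<^bsub>A\<^esub> Q (Q u \<otimes>\<^bsub>A\<^esub> v)"
proof -
  have "x \<ominus>\<^bsub>A\<^esub> r \<oplus>\<^bsub>A\<^esub> r = x" if "x \<in> carrier A" "r \<in> carrier A" for x r
    using that by (simp add: a_minus_def M.a_assoc M.l_neg)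
  then show ?thesis
    by (subst reynolds_identity) (use assms in auto)
qed

text \<open>Think of \<open>u\<close> as a product of \<open>k + 1\<close> values of
  \<open>Q\<close> and of \<open>d\<close> as its derivative. Hypothesis \<open>d\<close> is then
  the recursion for \<open>u\<close>, and the conclusion is the recursion for \<open>u\<close> with
  the factor \<open>Q a\<close> put in front, its derivative given by the Leibniz rule.\<close>

lemma Q_product_step:
  assumes [simp]: "a \<in> carrier A" "u \<in> carrier A" "d \<in> carrier A"
    and d: "Q d = k \<odot>\<^bsub>A\<^esub> Q u \<oplus>\<^bsub>A\<^esub> u"
  shows "Q (a \<otimes>\<^bsub>A\<^esub> u \<oplus>\<^bsub>A\<^esub> Q a \<otimes>\<^bsub>A\<^esub> d) =
    (k + 1) \<odot>\<^bsub>A\<^esub> Q (Q a \<otimes>\<^bsub>A\<^esub> u) \<oplus>\<^bsub>A\<^esub> Q a \<otimes>\<^bsub>A\<^esub> u"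
proof -
  define p q r s t x y where "p = Q (a \<otimes>\<^bsub>A\<^esub> Q u)" and "q = Q (Q a \<otimes>\<^bsub>A\<^esub> u)"
    and "r = Q (Q a \<otimes>\<^bsub>A\<^esub> Q u)" and "s = Q a \<otimes>\<^bsub>A\<^esub> Q u" and "t = Q a \<otimes>\<^bsub>A\<^esub> u"
    and "x = Q (a \<otimes>\<^bsub>A\<^esub> u)" and "y = Q (Q a \<otimes>\<^bsub>A\<^esub> d)"
  note defs = this
  have closed [simp]: "p \<in> carrier A" "q \<in> carrier A" "r \<in> carrier A" "s \<in> carrier A"
      "t \<in> carrier A" "x \<in> carrier A" "y \<in> carrier A"
    by (simp_all add: defs)
  \<comment> \<open>The Reynolds identity for \<open>a\<close> and \<open>u\<close>, multiplied by
    \<open>k\<close>. The next fact is the identity for \<open>a\<close> and \<open>d\<close>, with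
    \<open>Q d\<close> expanded. Combining the two removes \<open>p\<close>, \<open>r\<close> and
    \<open>s\<close>, the terms that contain \<open>Q u\<close>.\<close>
  have 1: "k \<odot>\<^bsub>A\<^esub> s \<oplus>\<^bsub>A\<^esub> k \<odot>\<^bsub>A\<^esub> r = k \<odot>\<^bsub>A\<^esub> p \<oplus>\<^bsub>A\<^esub> k \<odot>\<^bsub>A\<^esub> q"
    using arg_cong[OF reynolds_identity_add[of a u], of "\<lambda>z. k \<odot>\<^bsub>A\<^esub> z"]
    by (simp add: defs smult_r_distr)
  have 2: "(k \<odot>\<^bsub>A\<^esub> s \<oplus>\<^bsub>A\<^esub> t) \<oplus>\<^bsub>A\<^esub> (k \<odot>\<^bsub>A\<^esub> r \<oplus>\<^bsub>A\<^esub> q) = (k \<odot>\<^bsub>A\<^esub> p \<oplus>\<^bsub>A\<^esub> x) \<oplus>\<^bsub>A\<^esub> y"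
    using reynolds_identity_add[of a d]
    by (simp add: d defs r_distr P_add P_smult flip: smult_mult_right)
  have "k \<odot>\<^bsub>A\<^esub> p \<oplus>\<^bsub>A\<^esub> (x \<oplus>\<^bsub>A\<^esub> y) = (k \<odot>\<^bsub>A\<^esub> s \<oplus>\<^bsub>A\<^esub> k \<odot>\<^bsub>A\<^esub> r) \<oplus>\<^bsub>A\<^esub> (q \<oplus>\<^bsub>A\<^esub> t)"
    using 2 by (simp add: M.a_ac)
  also have "\<dots> = k \<odot>\<^bsub>A\<^esub> p \<oplus>\<^bsub>A\<^esub> (k \<odot>\<^bsub>A\<^esub> q \<oplus>\<^bsub>A\<^esub> q \<oplus>\<^bsub>A\<^esub> t)"
    unfolding 1 by (simp add: M.a_ac)
  finally have "x \<oplus>\<^bsub>A\<^esub> y = k \<odot>\<^bsub>A\<^esub> q \<oplus>\<^bsub>A\<^esub> q \<oplus>\<^bsub>A\<^esub> t"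
    by simp
  then show ?thesis
    by (simp add: defs P_add smult_add_left)
qed

lemma ev_closed [simp]: "w \<in> reynolds_words V \<Longrightarrow> ev w \<in> carrier A"
  using f_closed by (induction w rule: bword_induct) auto

lemma ev_append:
  "u \<in> reynolds_words V \<Longrightarrow> v \<in> reynolds_words V \<Longrightarrow> ev (u @ v) = ev u \<otimes>\<^bsub>A\<^esub> ev v"
  using f_closed by (induction u rule: bword_induct) (auto simp: m_assoc Pi_iff)

lemma lin_eval_superset:
  assumes "finite S" "Poly_Mapping.keys p \<subseteq> S" "S \<subseteq> reynolds_words V"
  shows "lin_eval p = (\<Oplus>\<^bsub>A\<^esub>w\<in>S. Poly_Mapping.lookup p w \<odot>\<^bsub>A\<^esub> ev w)"
  unfolding lin_eval_def
  by (rule M.add.finprod_mono_neutral_cong_left) (use assms in \<open>auto simp: in_keys_iff\<close>)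

lemma lin_eval_closed:
  "Poly_Mapping.keys p \<subseteq> reynolds_words V \<Longrightarrow> lin_eval p \<in> carrier A"
  unfolding lin_eval_def by (rule M.finsum_closed) auto

lemma lin_eval_zero: "lin_eval 0 = \<zero>\<^bsub>A\<^esub>"
  by (simp add: lin_eval_def)

lemma lin_eval_single:
  "w \<in> reynolds_words V \<Longrightarrow> lin_eval (Poly_Mapping.single w c) = c \<odot>\<^bsub>A\<^esub> ev w"
  by (subst lin_eval_superset[of "{w}"]) auto

lemma lin_eval_add:
  assumes "Poly_Mapping.keys p \<subseteq> reynolds_words V" "Poly_Mapping.keys q \<subseteq> reynolds_words V"
  shows "lin_eval (p + q) = lin_eval p \<oplus>\<^bsub>A\<^esub> lin_eval q"
proof -
  define S where "S = Poly_Mapping.keys p \<union> Poly_Mapping.keys q"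
  have S: "finite S" "Poly_Mapping.keys p \<subseteq> S" "Poly_Mapping.keys q \<subseteq> S"
      "Poly_Mapping.keys (p + q) \<subseteq> S" "S \<subseteq> reynolds_words V"
    using keys_add[of p q] assms by (auto simp: S_def)
  then have "lin_eval (p + q) = (\<Oplus>\<^bsub>A\<^esub>w\<in>S. Poly_Mapping.lookup p w \<odot>\<^bsub>A\<^esub> ev w
      \<oplus>\<^bsub>A\<^esub> Poly_Mapping.lookup q w \<odot>\<^bsub>A\<^esub> ev w)"
    unfolding lin_eval_superset[OF S(1,4,5)]
    by (intro M.finsum_cong') (auto simp: lookup_add smult_add_left)
  also have "\<dots> = lin_eval p \<oplus>\<^bsub>A\<^esub> lin_eval q"
    unfolding lin_eval_superset[OF S(1,2,5)] lin_eval_superset[OF S(1,3,5)]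
    by (intro M.finsum_addf) (use S(5) in auto)
  finally show ?thesis .
qed

lemma lin_eval_smult:
  assumes "Poly_Mapping.keys p \<subseteq> reynolds_words V"
  shows "lin_eval (Poly_Mapping.single [] c * p) = c \<odot>\<^bsub>A\<^esub> lin_eval p"
  using assms
proof (induction rule: poly_mapping_span_induct)
  case (add p q)
  then have "Poly_Mapping.keys (Poly_Mapping.single [] c * p) \<subseteq> reynolds_words V"
      "Poly_Mapping.keys (Poly_Mapping.single [] c * q) \<subseteq> reynolds_words V"
    using keys_scalar_mult by blast+
  with add show ?case
    by (simp add: distrib_left lin_eval_add lin_eval_closed smult_r_distr)
qed (simp_all add: lin_eval_zero lin_eval_single scalar_mult_single smult_smult)

lemma lin_eval_mult:
  assumes "Poly_Mapping.keys p \<subseteq> reynolds_words V" "Poly_Mapping.keys q \<subseteq> reynolds_words V"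
  shows "lin_eval (p * q) = lin_eval p \<otimes>\<^bsub>A\<^esub> lin_eval q"
  using assms(1)
proof (induction rule: poly_mapping_span_induct)
  case (add p r)
  then show ?case
    using assms(2)
    by (simp add: distrib_right lin_eval_add lin_eval_closed l_distr keys_mult_reynolds_words)
next
  case (single u c)
  have keys_single: "Poly_Mapping.keys (Poly_Mapping.single u c) \<subseteq> reynolds_words V"
    using single by simp
  from assms(2) show ?case
  proof (induction rule: poly_mapping_span_induct)
    case (add q r)
    then show ?case
      using single keys_single
      by (simp add: distrib_left lin_eval_add lin_eval_closed r_distr keys_mult_reynolds_words
          del: keys_single)
  next
    case (single v d)
    then show ?case
      using \<open>u \<in> reynolds_words V\<close>
      by (simp add: mult_single plus_list_def lin_eval_single ev_append mult.commute
          flip: smult_mult_left smult_mult_right smult_smult)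
  qed (use single in \<open>simp_all add: lin_eval_zero lin_eval_single\<close>)
qed (use assms(2) in \<open>simp_all add: lin_eval_zero lin_eval_closed\<close>)

section \<open>Compatibility of the evaluation with the operators\<close>

lemma keys_bracket_deriv:
  "map Br us \<in> reynolds_words V \<Longrightarrow>
    Poly_Mapping.keys (bracket_deriv (map Br us) :: 'x bword \<Rightarrow>\<^sub>0 'k) \<subseteq> reynolds_words V"
  by (induction us) (simp_all add: keys_add_reynolds_words keys_mult_reynolds_words)

text \<open>In any Reynolds algebra the identity forces, on products of values of \<open>Q\<close>,
  the recursion that defines \<open>bracket_op\<close>. A single factor, with coefficient 0, starts
  the induction.\<close>

lemma Q_lin_eval_bracket_deriv:
  assumes "us \<noteq> []" "map Br us \<in> reynolds_words V"
  shows "Q (lin_eval (bracket_deriv (map Br us))) =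
    of_nat (length us - 1) \<odot>\<^bsub>A\<^esub> Q (ev (map Br us)) \<oplus>\<^bsub>A\<^esub> ev (map Br us)"
  using assms
proof (induction us)
  case (Cons s us)
  then have s: "s \<in> reynolds_words V" "[Br s] \<in> reynolds_words V"
    and us: "map Br us \<in> reynolds_words V" by auto
  show ?case
  proof (cases "us = []")
    case True
    then show ?thesis
      using s by (simp add: lin_eval_single)
  next
    case False
    have "lin_eval (bracket_deriv (map Br (s # us))) = ev s \<otimes>\<^bsub>A\<^esub> ev (map Br us)
        \<oplus>\<^bsub>A\<^esub> Q (ev s) \<otimes>\<^bsub>A\<^esub> lin_eval (bracket_deriv (map Br us))"
      using s us keys_bracket_deriv[OF us]
      by (simp add: lin_eval_add lin_eval_mult lin_eval_single ev_append keys_mult_reynolds_words)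
    \<comment> \<open>Since \<open>us\<close> is nonempty, the truncated subtraction is exact, and
      the coefficient rises by one with the new factor.\<close>
    moreover have "of_nat (length us - 1) + 1 = (of_nat (length us) :: 'k)"
      using False by (cases us) auto
    ultimately show ?thesis
      using Q_product_step[of "ev s" "ev (map Br us)" "lin_eval (bracket_deriv (map Br us))"
          "of_nat (length us - 1)"] Cons.IH False s us keys_bracket_deriv[OF us]
      by (simp add: lin_eval_closed)
  qed
qed simp

text \<open>On bracket products both sides solve the same equation: \<open>k\<close> times the side
  plus \<open>ev w\<close> is \<open>Q (lin_eval D)\<close>. As \<open>k\<close> is nonzero it can
  be cancelled. On other words the operator just adds a bracket, which \<open>word_eval\<close>
  sends to \<open>Q\<close>.\<close>

lemma lin_eval_bracket_op:
  "w \<in> reynolds_words V \<Longrightarrow> lin_eval (bracket_op w) = Q (ev w)"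
proof (induction "size_list size w" arbitrary: w rule: less_induct)
  case less
  show ?case
  proof (cases "bracket_product w")
    case True
    then obtain us where us: "w = map Br us" "length us \<ge> 2"
      by (auto simp: bracket_product_def)
    define D :: "'x bword \<Rightarrow>\<^sub>0 'k" where "D = bracket_deriv w"
    define k :: 'k where "k = of_nat (length us - 1)"
    have "length w = Suc (length us - 1)" "k \<noteq> 0"
      using us by (simp_all add: k_def del: of_nat_diff)
    then have k: "k \<noteq> 0" "of_nat (length w) = 1 + (Poly_Mapping.single [] k :: 'x bword \<Rightarrow>\<^sub>0 'k)"
      by (simp_all only: k_def of_nat_Suc not_False_eq_True flip: of_nat_eq_scalar)
    \<comment> \<open>All words in \<open>D\<close> are smaller Reynolds words, so the induction
      hypothesis extends linearly to \<open>D\<close>.\<close>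
    have "Poly_Mapping.keys D \<subseteq> {v \<in> reynolds_words V. size_list size v < size_list size w}"
      unfolding D_def bracket_deriv_sum
      by (rule keys_sum_subset)
        (use splice_in_reynolds_words[OF True less(2)] size_bracket_splice[OF True] in auto)
    then have "lin_eval (reynolds_op D) = Q (lin_eval D)"
    proof (induction rule: poly_mapping_span_induct)
      case (add p q)
      then have "Poly_Mapping.keys p \<subseteq> reynolds_words V" "Poly_Mapping.keys q \<subseteq> reynolds_words V"
        by auto
      with add show ?case
        by (simp add: reynolds_op_add lin_eval_add keys_reynolds_op P_add lin_eval_closed)
    next
      case (single v c)
      then show ?case
        using less(1)[of v]
        by (simp add: reynolds_op_single lin_eval_smult keys_bracket_op lin_eval_single P_smult)
    qed (simp_all add: op.zero lin_eval_zero Q_zero)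
    also have "\<dots> = k \<odot>\<^bsub>A\<^esub> Q (ev w) \<oplus>\<^bsub>A\<^esub> ev w"
      using Q_lin_eval_bracket_deriv[of us] us less(2) by (force simp: D_def k_def)
    also have "reynolds_op D = Poly_Mapping.single [] k * bracket_op w + word w"
      using reynolds_op_bracket_product[OF True, where 'k = 'k]
      by (simp add: D_def k reynolds_op_word distrib_right algebra_simps)
    finally have eq: "lin_eval (Poly_Mapping.single [] k * bracket_op w + word w) =
        k \<odot>\<^bsub>A\<^esub> Q (ev w) \<oplus>\<^bsub>A\<^esub> ev w" .
    have op: "Poly_Mapping.keys (bracket_op w :: 'x bword \<Rightarrow>\<^sub>0 'k) \<subseteq> reynolds_words V"
      by (rule keys_bracket_op[OF less(2)])
    then have "Poly_Mapping.keys (Poly_Mapping.single [] k * bracket_op w) \<subseteq> reynolds_words V"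
      using keys_scalar_mult[of k "bracket_op w"] by blast
    with eq op have "k \<odot>\<^bsub>A\<^esub> lin_eval (bracket_op w) \<oplus>\<^bsub>A\<^esub> ev w = k \<odot>\<^bsub>A\<^esub> Q (ev w) \<oplus>\<^bsub>A\<^esub> ev w"
      using less(2) by (simp add: lin_eval_add lin_eval_smult lin_eval_single)
    then have "k \<odot>\<^bsub>A\<^esub> lin_eval (bracket_op w) = k \<odot>\<^bsub>A\<^esub> Q (ev w)"
      using less(2) op by (simp add: lin_eval_closed)
    then show ?thesis
      by (rule smult_cancel) (use k less(2) op in \<open>auto simp: lin_eval_closed\<close>)
  next
    case False
    then show ?thesis
      using less(2) by (simp add: bracket_op.simps[of w] lin_eval_single)
  qed
qed

lemma lin_eval_reynolds_op:
  assumes "Poly_Mapping.keys p \<subseteq> reynolds_words V"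
  shows "lin_eval (reynolds_op p) = Q (lin_eval p)"
  using assms
proof (induction rule: poly_mapping_span_induct)
  case (add p q)
  then show ?case
    by (simp add: reynolds_op_add lin_eval_add keys_reynolds_op P_add lin_eval_closed)
qed (simp_all add: op.zero lin_eval_zero Q_zero reynolds_op_single lin_eval_smult
    keys_bracket_op lin_eval_bracket_op lin_eval_single P_smult)

section \<open>Existence and uniqueness of the extension\<close>

lemma lin_eval_in_reynolds_hom:
  "restrict lin_eval (carrier (reynolds_word_algebra V)) \<in>
    reynolds_hom (ring_of_type_algebra :: 'k ring) (reynolds_word_algebra V) reynolds_op A Q"
  by (auto simp: reynolds_hom_def ring_hom_def lin_eval_closed lin_eval_mult lin_eval_add
      lin_eval_smult lin_eval_reynolds_op one_eq_word lin_eval_single keys_mult_reynolds_words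
      keys_add_reynolds_words keys_reynolds_op subsetD[OF keys_scalar_mult]
      simp flip: smult_mult_left)

text \<open>Every Reynolds word arises from the empty word and the generators by products and the
  operator, so a homomorphism is determined by its values on generators.\<close>

lemma reynolds_hom_eq_lin_eval:
  assumes g: "g \<in> reynolds_hom (ring_of_type_algebra :: 'k ring) (reynolds_word_algebra V) reynolds_op A Q"
    and gen: "\<And>x. x \<in> V \<Longrightarrow> g (generator x) = f x"
    and p: "Poly_Mapping.keys p \<subseteq> reynolds_words V"
  shows "g p = lin_eval p"
proof -
  let ?F = "reynolds_word_algebra V :: ('k, 'x bword \<Rightarrow>\<^sub>0 'k) module"
  have hom: "g \<in> ring_hom ?F A"
    using g by (simp add: reynolds_hom_def)
  have mult: "g (p * q) = g p \<otimes>\<^bsub>A\<^esub> g q" and add: "g (p + q) = g p \<oplus>\<^bsub>A\<^esub> g q"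
    if "Poly_Mapping.keys p \<subseteq> reynolds_words V" "Poly_Mapping.keys q \<subseteq> reynolds_words V" for p q
    using ring_hom_mult[OF hom, of p q] ring_hom_add[OF hom, of p q] that by simp_all
  have one: "g (word []) = \<one>\<^bsub>A\<^esub>"
    using ring_hom_one[OF hom] by (simp add: one_eq_word)
  have smult: "g (Poly_Mapping.single [] c * p) = c \<odot>\<^bsub>A\<^esub> g p"
    and op: "g (reynolds_op p) = Q (g p)"
    if "Poly_Mapping.keys p \<subseteq> reynolds_words V" for c p
    using g that by (auto simp: reynolds_hom_def)
  have word: "w \<in> reynolds_words V \<Longrightarrow> g (word w) = ev w" for w
  proof (induction w rule: bword_induct)
    case (Var x w)
    have "g (word (Var x # w)) = g (generator x * word w)"
      by (simp add: generator_def word_mult)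
    also have "\<dots> = g (generator x) \<otimes>\<^bsub>A\<^esub> g (word w)"
      by (rule mult) (use Var.prems in \<open>simp_all add: generator_def\<close>)
    finally show ?case
      using Var gen by simp
  next
    case (Br u w)
    \<comment> \<open>In a Reynolds word the content \<open>u\<close> of a bracket is not a bracket
      product, so \<open>Br u\<close> is the operator applied to \<open>u\<close>.\<close>
    then have "g (word (Br u # w)) = g (reynolds_op (word u) * word w)"
      by (simp add: reynolds_op_bracket word_mult)
    also have "\<dots> = g (reynolds_op (word u)) \<otimes>\<^bsub>A\<^esub> g (word w)"
      by (rule mult) (use Br.prems in \<open>simp_all add: keys_reynolds_op\<close>)
    finally show ?case
      using Br by (simp add: op)
  qed (simp add: one)
  from p show ?thesis
  proof (induction rule: poly_mapping_span_induct)
    \<comment> \<open>\<open>ring_hom\<close> does not mention zero; it is reached by scaling the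
      unit with 0.\<close>
    case zero
    show ?case
      using smult[of "word []" 0] by (simp add: one lin_eval_zero)
  next
    case (single w c)
    then show ?case
      using smult[of "word w" c] by (simp add: scalar_mult_single word lin_eval_single)
  qed (simp add: add lin_eval_add)
qed

text \<open>Functions are total, so uniqueness makes sense only once the values off the carrier are
  fixed; \<open>extensional\<close> and \<open>restrict\<close> do that.\<close>

lemma ex1_generator_map:
  "\<exists>!g. g \<in> extensional (carrier (reynolds_word_algebra V)) \<and>
    g \<in> reynolds_hom (ring_of_type_algebra :: 'k ring) (reynolds_word_algebra V) reynolds_op A Q \<and>
    (\<forall>x\<in>V. g (generator x) = f x)"
proof (rule ex1I[of _ "restrict lin_eval (carrier (reynolds_word_algebra V))"])
  have "lin_eval (generator x) = f x" if "x \<in> V" for x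
    using that f_closed by (auto simp: generator_def lin_eval_single Pi_iff)
  then show "restrict lin_eval (carrier (reynolds_word_algebra V))
      \<in> extensional (carrier (reynolds_word_algebra V)) \<and>
    restrict lin_eval (carrier (reynolds_word_algebra V)) \<in>
      reynolds_hom (ring_of_type_algebra :: 'k ring) (reynolds_word_algebra V) reynolds_op A Q \<and>
    (\<forall>x\<in>V. restrict lin_eval (carrier (reynolds_word_algebra V)) (generator x) = f x)"
    using lin_eval_in_reynolds_hom by (simp add: generator_def)
next
  fix g
  assume g: "g \<in> extensional (carrier (reynolds_word_algebra V)) \<and>
    g \<in> reynolds_hom (ring_of_type_algebra :: 'k ring) (reynolds_word_algebra V) reynolds_op A Q \<and>
    (\<forall>x\<in>V. g (generator x) = f x)"
  show "g = restrict lin_eval (carrier (reynolds_word_algebra V))"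
    by (rule extensionalityI[of _ "carrier (reynolds_word_algebra V)"])
      (use g reynolds_hom_eq_lin_eval[of g] in auto)
qed

end

theorem theorem3p9:
  fixes V :: "'x set"
  defines "K \<equiv> (ring_of_type_algebra :: 'k::field_char_0 ring)"
    and "F \<equiv> (reynolds_word_algebra V :: ('k, 'x bword \<Rightarrow>\<^sub>0 'k) module)"
  shows "reynolds_algebra K F reynolds_op \<and>
    generator \<in> V \<rightarrow> carrier F \<and>
    (\<forall>(A :: ('k, 'a) module) Q f.
      reynolds_algebra K A Q \<longrightarrow> f \<in> V \<rightarrow> carrier A \<longrightarrow>
      (\<exists>!g. g \<in> extensional (carrier F) \<and>
        g \<in> reynolds_hom K F reynolds_op A Q \<and>
        (\<forall>x\<in>V. g (generator x) = f x)))"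
proof (intro conjI allI impI)
  show "reynolds_algebra K F reynolds_op"
    unfolding K_def F_def by (rule reynolds_algebra_reynolds_word_algebra)
  show "generator \<in> V \<rightarrow> carrier F"
    by (simp add: F_def generator_def)
next
  fix A :: "('k, 'a) module" and Q f
  assume "reynolds_algebra K A Q" "f \<in> V \<rightarrow> carrier A"
  then have "generator_map A Q V f"
    unfolding K_def by (intro generator_map.intro generator_map_axioms.intro)
  then show "\<exists>!g. g \<in> extensional (carrier F) \<and> g \<in> reynolds_hom K F reynolds_op A Q \<and>
      (\<forall>x\<in>V. g (generator x) = f x)"
    unfolding K_def F_def by (rule generator_map.ex1_generator_map)
qed

end
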